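(* Let $l<h$ be arbitrary values (possibly depending on the number $n$ of agents), and suppose that the private valuations take on only the two values $l$ and $h$. There does not exist a polynomial-time, monotone, welfare-preserving transformation (for downward-closed single-parameter environments), even when the transformation is allowed to be randomized and adaptive and make a polynomial number of queries to the feasibility set $\mathcal{F}$.
   Context: A single-parameter environment consists of $n$ agents, where agent $i$ has a private valuation $v_i\in\mathbb{R}$ (its value per unit of stuff that it gets; here $v_i\in\{l,h\}$), and a feasibility set $\mathcal{F}$ whose elements, the feasible allocations, are vectors $\mathbf{x}=(x_i)_{i=1}^n$ with $x_i\in\mathbb{R}$ denoting the amount of stuff given to agent $i$. The environment is downward-closed if, whenever we take an allocation in $\mathcal{F}$ and decrease the amount of stuff given to one of the agents, the resulting allocation is also in $\mathcal{F}$. An algorithm (or allocation rule) $\mathcal{A}$ is a function that takes a valuation vector $\mathbf{v}=(v_i)_{i=1}^n$ (the input) and outputs an allocation $\mathbf{x}\in\mathcal{F}$. The welfare of $\mathcal{A}$ at $\mathbf{v}$ is $\mathbf{v}\cdot\mathbf{x}=v_1x_1+\dots+v_nx_n$. An allocation rule is monotone if, whenever an agent increases its declared valuation while the declared valuations of the remaining agents stay fixed, the agent is allocated at least as much stuff as before. A transformation $\mathcal{T}$ is an algorithm that has black-box access to some other algorithm $\mathcal{A}$: in each query it specifies a valuation vector and obtains the allocation that $\mathcal{A}$ returns there. $\mathcal{T}(\mathcal{A})$ denotes $\mathcal{T}$ with access to $\mathcal{A}$. $\mathcal{T}$ has the knowledge that $\mathcal{F}$ is downward-closed. A query to $\mathcal{F}$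 asks whether a particular allocation belongs to $\mathcal{F}$. $\mathcal{T}$ is adaptive if it can adjust its next query based on the responses it received for previous queries. Polynomial means polynomial in $n$. $\mathcal{T}$ is monotone if $\mathcal{T}(\mathcal{A})$ is a monotone allocation rule for any algorithm $\mathcal{A}$. $\mathcal{T}$ is welfare-preserving if, for any algorithm $\mathcal{A}$, $\mathcal{T}(\mathcal{A})$ preserves the welfare of $\mathcal{A}$ at every input, i.e. its welfare at every input is at least that of $\mathcal{A}$.
   Formalization: The low value l is assumed positive for every n; for l ≤ 0 the claim fails, since giving each low agent the minimum of its amounts at v and at v with its own value raised to h is monotone, welfare-preserving and uses n+1 queries. *)

theory Defs
  imports "HOL-Probability.Probability_Mass_Function" "HOL-Computational_Algebra.Polynomial"
begin

text \<open>
  Agents are the numbers \<open>i < n\<close>. Valuation vectors and allocations are both points of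
  \<open>\<real>\<^sup>n\<close>, represented as functions that are \<open>undefined\<close> outside \<open>{..<n}\<close>, so that equal
  vectors are equal functions. Amounts of stuff may be negative.
\<close>

type_synonym rvec = "nat \<Rightarrow> real"

definition valuations :: "real \<Rightarrow> real \<Rightarrow> nat \<Rightarrow> rvec set" where
  "valuations l h n = ({..<n} \<rightarrow>\<^sub>E {l, h})"

definition allocations :: "nat \<Rightarrow> rvec set" where
  "allocations n = ({..<n} \<rightarrow>\<^sub>E UNIV)"

definition downward_closed :: "nat \<Rightarrow> rvec set \<Rightarrow> bool" where
  "downward_closed n F \<longleftrightarrow>
     F \<subseteq> allocations n \<and> (\<forall>x\<in>F. \<forall>i<n. \<forall>a\<le>x i. x(i := a) \<in> F)"

definition algorithm :: "rvec set \<Rightarrow> rvec set \<Rightarrow> (rvec \<Rightarrow> rvec) \<Rightarrow> bool" where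
  "algorithm V F A \<longleftrightarrow> (\<forall>v\<in>V. A v \<in> F)"

definition welfare :: "nat \<Rightarrow> rvec \<Rightarrow> rvec \<Rightarrow> real" where
  "welfare n v x = (\<Sum>i<n. v i * x i)"

text \<open>
  An adaptive randomized computation with oracle access to an algorithm and to a feasibility set.
  The next action may be an arbitrary function of the answers and coin outcomes seen so far; the
  bias of a coin may be any real in \<open>[0, 1]\<close>.
\<close>

datatype computation =
    Output rvec
  | Query_Alg rvec "rvec \<Rightarrow> computation"
  | Query_Feas rvec "bool \<Rightarrow> computation"
  | Toss real "bool \<Rightarrow> computation"

primrec outcome :: "(rvec \<Rightarrow> rvec) \<Rightarrow> rvec set \<Rightarrow> computation \<Rightarrow> rvec pmf" where
  "outcome A F (Output x) = return_pmf x"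
| "outcome A F (Query_Alg w k) = outcome A F (k (A w))"
| "outcome A F (Query_Feas z k) = outcome A F (k (z \<in> F))"
| "outcome A F (Toss p k) = bind_pmf (bernoulli_pmf p) (\<lambda>b. outcome A F (k b))"

text \<open>
  Worst-case time over the coin outcomes. Every oracle call and every coin toss costs one step, and
  the computation between them is free. This is a lower bound on the running time in any concrete
  machine model, so the polynomial-time transformations below include those of every such model.
\<close>

primrec time :: "(rvec \<Rightarrow> rvec) \<Rightarrow> rvec set \<Rightarrow> computation \<Rightarrow> nat" where
  "time A F (Output x) = 0"
| "time A F (Query_Alg w k) = Suc (time A F (k (A w)))"
| "time A F (Query_Feas z k) = Suc (time A F (k (z \<in> F)))"
| "time A F (Toss p k) = Suc (max (time A F (k True)) (time A F (k False)))"

text \<open>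
  A transformation is given the number of agents and the input vector. It depends on the algorithm
  and on the feasibility set through its queries only. On a downward-closed environment its
  output has to be feasible for all coin outcomes.
\<close>

type_synonym transf = "nat \<Rightarrow> rvec \<Rightarrow> computation"

definition apply_transf ::
    "transf \<Rightarrow> nat \<Rightarrow> rvec set \<Rightarrow> (rvec \<Rightarrow> rvec) \<Rightarrow> rvec \<Rightarrow> rvec pmf" where
  "apply_transf T n F A v = outcome A F (T n v)"

definition transformation :: "(nat \<Rightarrow> real) \<Rightarrow> (nat \<Rightarrow> real) \<Rightarrow> transf \<Rightarrow> bool" where
  "transformation l h T \<longleftrightarrow>
     (\<forall>n F A. downward_closed n F \<and> algorithm (valuations (l n) (h n) n) F A \<longrightarrow>
        (\<forall>v\<in>valuations (l n) (h n) n. set_pmf (apply_transf T n F A v) \<subseteq> F))"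

definition polynomial_time :: "(nat \<Rightarrow> real) \<Rightarrow> (nat \<Rightarrow> real) \<Rightarrow> transf \<Rightarrow> bool" where
  "polynomial_time l h T \<longleftrightarrow>
     (\<exists>p :: nat poly. \<forall>n F A.
        downward_closed n F \<and> algorithm (valuations (l n) (h n) n) F A \<longrightarrow>
        (\<forall>v\<in>valuations (l n) (h n) n. time A F (T n v) \<le> poly p n))"

text \<open>
  For randomized allocation rules, monotonicity and welfare are understood in expectation. All
  distributions produced by \<^const>\<open>outcome\<close> have finite support, so these expectations exist.
\<close>

definition monotone_rule :: "real \<Rightarrow> real \<Rightarrow> nat \<Rightarrow> (rvec \<Rightarrow> rvec pmf) \<Rightarrow> bool" where
  "monotone_rule l h n R \<longleftrightarrow>
     (\<forall>v\<in>valuations l h n. \<forall>i<n. \<forall>a\<in>{l, h}. v i \<le> a \<longrightarrow>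
        measure_pmf.expectation (R v) (\<lambda>x. x i)
          \<le> measure_pmf.expectation (R (v(i := a))) (\<lambda>x. x i))"

definition monotone_transformation :: "(nat \<Rightarrow> real) \<Rightarrow> (nat \<Rightarrow> real) \<Rightarrow> transf \<Rightarrow> bool" where
  "monotone_transformation l h T \<longleftrightarrow>
     (\<forall>n F A. downward_closed n F \<and> algorithm (valuations (l n) (h n) n) F A \<longrightarrow>
        monotone_rule (l n) (h n) n (apply_transf T n F A))"

definition welfare_preserving :: "(nat \<Rightarrow> real) \<Rightarrow> (nat \<Rightarrow> real) \<Rightarrow> transf \<Rightarrow> bool" where
  "welfare_preserving l h T \<longleftrightarrow>
     (\<forall>n F A. downward_closed n F \<and> algorithm (valuations (l n) (h n) n) F A \<longrightarrow>
        (\<forall>v\<in>valuations (l n) (h n) n.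
           welfare n v (A v)
             \<le> measure_pmf.expectation (apply_transf T n F A v) (welfare n v)))"

end

theory Submission
  imports Defs
begin

text \<open>
  Take \<open>n = 3m\<close> agents: \<open>m\<close> chain agents and \<open>2m\<close> agents that always report \<open>l\<close>. For a
  secret set \<open>S\<close> of chain agents the algorithm returns \<open>0\<close>, except on the input where exactly the
  members of \<open>S\<close> are high: there it returns a vector that gives each chain agent \<open>j\<close> outside
  \<open>S\<close> a rapidly increasing amount \<open>c j\<close> and has a barely positive welfare. Welfare forces the
  transformation to return that vector on this input. Raise the agents outside \<open>S\<close> to \<open>h\<close> one
  after the other. Monotonicity forces the raised agent to keep its expected amount, and
  since the next amount dwarfs the total welfare available so far, withholding it from the next
  agent before that agent is raised would make the welfare negative. So the probability of an
  output with a positive coordinate decreases by at most \<open>1/(2m)\<close> per step and is still at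
  least \<open>1/2\<close> when all chain agents are high.

  This last input does not depend on \<open>S\<close>. The agents that always report \<open>l\<close> encode \<open>S\<close> as a
  password of length \<open>m\<close>: the allocations with an incomplete password are feasible for every \<open>S\<close>
  but have negative welfare. Hence each query, to the algorithm or to the feasibility set,
  distinguishes at most one of the \<open>2 ^ m\<close> sets \<open>S\<close> from the environment without a secret, where
  no coordinate of the output can be positive.
\<close>

section \<open>Welfare caps and the counting of distinguishing queries\<close>

lemma finite_set_pmf_outcome: "finite (set_pmf (outcome A F c))"
  by (induction c) auto

text \<open>Every coordinate except \<open>r\<close> is raised to its cap. The slack at
  \<open>r\<close> is kept, so that taking expectations leaves a term in the expected amount of
  agent \<open>r\<close>.\<close>

lemma welfare_le_cap:
  assumes "\<And>i. i < n \<Longrightarrow> 0 \<le> v i" and "\<And>i. i < n \<Longrightarrow> z i \<le> b i" and "r < n"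
  shows "welfare n v z \<le> welfare n v b + v r * (z r - b r)"
proof -
  have "(\<Sum>i\<in>{..<n} - {r}. v i * z i) \<le> (\<Sum>i\<in>{..<n} - {r}. v i * b i)"
    using assms by (intro sum_mono mult_left_mono) auto
  moreover have "welfare n v u = v r * u r + (\<Sum>i\<in>{..<n} - {r}. v i * u i)" for u
    unfolding welfare_def using assms(3) by (subst sum.remove[of _ r]) auto
  ultimately show ?thesis
    by (simp add: algebra_simps)
qed

text \<open>Follow the run in the environment \<open>A0\<close>, \<open>F0\<close>. Each query is
  answered differently for at most one index, and dropping that index costs at most 1 in the sum of
  probabilities. A coin toss only averages the two branches.\<close>

lemma sum_prob_outcome_le_time:
  assumes "finite I"
    and A: "\<And>w. \<exists>s. \<forall>t\<in>I - {s}. A t w = A0 w"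
    and F: "\<And>z. \<exists>s. \<forall>t\<in>I - {s}. z \<in> F t \<longleftrightarrow> z \<in> F0"
  shows "(\<Sum>t\<in>I. measure_pmf.prob (outcome (A t) (F t) c) B)
           \<le> time A0 F0 c + card I * measure_pmf.prob (outcome A0 F0 c) B"
proof -
  have step: "(\<Sum>t\<in>I. P t (g t)) \<le> 1 + (\<Sum>t\<in>I. P t y)"
    if "\<forall>t\<in>I - {s}. g t = y" and P: "\<And>t x. 0 \<le> P t x" "\<And>t x. P t x \<le> 1"
    for P :: "'a \<Rightarrow> 'b \<Rightarrow> real" and g y s
  proof -
    have "(\<Sum>t\<in>I. P t (g t)) \<le> (\<Sum>t\<in>I. of_bool (t = s) + P t y)"
      using that by (intro sum_mono) (auto simp: add_increasing2)
    also have "\<dots> = (\<Sum>t\<in>I. of_bool (t = s)) + (\<Sum>t\<in>I. P t y)"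
      by (simp add: sum.distrib)
    also have "(\<Sum>t\<in>I. of_bool (t = s)) \<le> (1::real)"
      using \<open>finite I\<close> by (simp add: of_bool_def)
    finally show ?thesis by simp
  qed
  \<comment> \<open>The weights stay in the form \<open>pmf (bernoulli_pmf p)\<close>, because
    \<open>p\<close> is not assumed to lie in the unit interval.\<close>
  have toss: "measure_pmf.prob (outcome A F (Toss p k)) B
      = pmf (bernoulli_pmf p) True * measure_pmf.prob (outcome A F (k True)) B
        + pmf (bernoulli_pmf p) False * measure_pmf.prob (outcome A F (k False)) B" for A F p k
    using pmf_expectation_bind[OF finite finite_set_pmf_outcome subset_UNIV,
      of "bernoulli_pmf p" "\<lambda>_. A" "\<lambda>_. F" k "indicator B :: rvec \<Rightarrow> real"]
    by (simp add: UNIV_bool del: pmf_bernoulli_True pmf_bernoulli_False)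
  show ?thesis
  proof (induction c)
    case (Output x)
    then show ?case by simp
  next
    case (Query_Alg w k)
    obtain s where "\<forall>t\<in>I - {s}. A t w = A0 w" using A by blast
    from step[OF this, of "\<lambda>t y. measure_pmf.prob (outcome (A t) (F t) (k y)) B"]
    show ?case using Query_Alg[of "k (A0 w)"] by simp
  next
    case (Query_Feas z k)
    obtain s where "\<forall>t\<in>I - {s}. (z \<in> F t) = (z \<in> F0)" using F by blast
    from step[OF this, of "\<lambda>t y. measure_pmf.prob (outcome (A t) (F t) (k y)) B"]
    show ?case using Query_Feas[of "k (z \<in> F0)"] by simp
  next
    case (Toss p k)
    define a b where "a = pmf (bernoulli_pmf p) True" and "b = pmf (bernoulli_pmf p) False"
    have ab: "a \<ge> 0" "b \<ge> 0" "a + b = 1"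
      using sum_pmf_eq_1[of UNIV "bernoulli_pmf p"] by (auto simp: a_def b_def UNIV_bool add.commute)
    define X where "X y = (\<Sum>t\<in>I. measure_pmf.prob (outcome (A t) (F t) (k y)) B)" for y
    define Y where "Y y = measure_pmf.prob (outcome A0 F0 (k y)) B" for y
    let ?M = "real (max (time A0 F0 (k True)) (time A0 F0 (k False)))"
    have X: "X y \<le> ?M + card I * Y y" for y
      using Toss[of "k y"] unfolding X_def Y_def by (cases y) auto
    have "(\<Sum>t\<in>I. measure_pmf.prob (outcome (A t) (F t) (Toss p k)) B) = a * X True + b * X False"
      by (simp only: toss a_def b_def X_def sum.distrib sum_distrib_left)
    also have "\<dots> \<le> a * (?M + card I * Y True) + b * (?M + card I * Y False)"
      using X ab by (intro add_mono mult_left_mono) auto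
    also have "\<dots> = (a + b) * ?M + card I * (a * Y True + b * Y False)"
      by (simp only: algebra_simps)
    also have "\<dots> \<le> time A0 F0 (Toss p k) + card I * measure_pmf.prob (outcome A0 F0 (Toss p k)) B"
      unfolding toss by (simp add: ab a_def[symmetric] b_def[symmetric] Y_def)
    finally show ?case .
  qed
qed

section \<open>Polynomials against powers of two\<close>

lemma nat_poly_le_monomial: "\<exists>C d. \<forall>x\<ge>1. poly (p :: nat poly) x \<le> C * x ^ d"
proof (induction p)
  case 0
  then show ?case by simp
next
  case (pCons a p)
  then obtain C d where le: "\<And>x. x \<ge> 1 \<Longrightarrow> poly p x \<le> C * x ^ d" by blast
  have "poly (pCons a p) x \<le> (a + C) * x ^ Suc d" if "x \<ge> 1" for x
  proof -
    have "a * 1 \<le> a * x ^ Suc d"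
      using that by (intro mult_le_mono2 one_le_power)
    moreover have "x * poly p x \<le> C * x ^ Suc d"
      using mult_le_mono2[OF le[OF that], of x] by (simp add: ac_simps)
    ultimately show ?thesis by (simp only: poly_pCons distrib_right mult_1_right add_mono)
  qed
  then show ?case by blast
qed

lemma nat_poly_less_power2: "\<exists>m>0. 2 * poly (p :: nat poly) (3 * m) < 2 ^ m"
proof -
  obtain C d where le: "\<And>x. x \<ge> 1 \<Longrightarrow> poly p x \<le> C * x ^ d"
    using nat_poly_le_monomial by blast
  have "((\<lambda>x. x ^ d / exp x) \<longlongrightarrow> (0::real)) at_top"
    by (rule tendsto_power_div_exp_0)
  then have "((\<lambda>m. (real m * ln 2) ^ d / exp (real m * ln 2)) \<longlongrightarrow> 0) sequentially"
    by (rule filterlim_compose)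
       (auto intro!: filterlim_at_top_mult_tendsto_pos filterlim_real_sequentially)
  \<comment> \<open>The factor turns the quotient into
    \<open>2 * C * (3 * m) ^ d / 2 ^ m\<close>.\<close>
  then have "((\<lambda>m. (2 * real C * 3 ^ d / ln 2 ^ d) * ((real m * ln 2) ^ d / exp (real m * ln 2))) \<longlongrightarrow>
      (2 * real C * 3 ^ d / ln 2 ^ d) * 0) sequentially"
    by (intro tendsto_mult tendsto_const)
  then have "\<forall>\<^sub>F m in sequentially.
      (2 * real C * 3 ^ d / ln 2 ^ d) * ((real m * ln 2) ^ d / exp (real m * ln 2)) < 1"
    by (rule order_tendstoD(2)) simp
  moreover have "\<forall>\<^sub>F m::nat in sequentially. m > 0"
    by (rule eventually_gt_at_top)
  ultimately have "\<forall>\<^sub>F m::nat in sequentially. m > 0 \<and>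
      (2 * real C * 3 ^ d / ln 2 ^ d) * ((real m * ln 2) ^ d / exp (real m * ln 2)) < 1"
    by eventually_elim auto
  then obtain m :: nat where m: "m > 0"
    "(2 * real C * 3 ^ d / ln 2 ^ d) * ((real m * ln 2) ^ d / exp (real m * ln 2)) < 1"
    using eventually_happens'[OF sequentially_bot] by blast
  have "exp (real m * ln 2) = 2 ^ m"
    by (simp add: exp_of_nat_mult)
  with m(2) have "2 * real C * (3 * real m) ^ d < 2 ^ m"
    by (simp add: field_simps)
  then have "real (2 * (C * (3 * m) ^ d)) < real (2 ^ m)"
    by simp
  then have "2 * (C * (3 * m) ^ d) < 2 ^ m"
    by (simp only: of_nat_less_iff)
  moreover have "poly p (3 * m) \<le> C * (3 * m) ^ d"
    using m(1) by (intro le) auto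
  ultimately show ?thesis using m(1) by (intro exI[of _ m]) linarith
qed

section \<open>The environments with a hidden set\<close>

locale hidden_set =
  fixes m :: nat and l h :: real
  assumes m_pos: "0 < m" and l_pos: "0 < l" and l_less_h: "l < h"
begin

text \<open>The solution of \<open>l * q = l + 2 * m * h\<close>: adding \<open>h * c r\<close> to
  the welfare bound \<open>M r\<close> multiplies it by \<open>q\<close>.\<close>

definition q :: real where "q = 1 + 2 * m * h / l"

text \<open>
  The weights satisfy \<open>c r = 2 * m * M r / l\<close>, where \<open>M r = l * m + h * (\<Sum>j<r. c j)\<close> bounds the
  welfare of the secret vector once the agents below \<open>r\<close> are high; see \<open>sum_c\<close>.
\<close>

definition c :: "nat \<Rightarrow> real" where "c i = 2 * m * (m * q ^ i)"

text \<open>By \<open>sum_c\<close>, \<open>l * a\<close> equals \<open>M m\<close>, so it exceeds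
  the welfare that the chain agents can contribute.\<close>

definition a :: real where "a = m * q ^ m"

definition input :: "nat set \<Rightarrow> rvec" where
  "input U = (\<lambda>i\<in>{..<3 * m}. if i \<in> U then h else l)"

text \<open>
  The agents \<open>m + j\<close> and \<open>2 * m + j\<close> encode whether \<open>j \<in> S\<close>; the summand \<open>- c j\<close> offsets the amount
  of the chain agent \<open>j\<close>, so that the welfare at \<open>input S\<close> is exactly \<open>l * m\<close>.
\<close>

definition hidden :: "nat set \<Rightarrow> rvec" where
  "hidden S = (\<lambda>i\<in>{..<3 * m}.
     if i < m then (if i \<in> S then 0 else c i)
     else if i < 2 * m then (if i - m \<in> S then - a else a + 1)
     else (if i - 2 * m \<in> S then a + 1 else - a - c (i - 2 * m)))"

definition big :: "rvec \<Rightarrow> nat set" where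
  "big z = {i\<in>{m..<3 * m}. - a < z i}"

definition nonpos :: "rvec set" where
  "nonpos = {z. \<forall>i<3 * m. z i \<le> 0}"

text \<open>In \<open>hidden S\<close> exactly \<open>m\<close> of the password amounts exceed
  \<open>- a\<close>. Lowering a single one of them to \<open>- a\<close> gives a decoy, which is
  feasible whatever the secret is.\<close>

definition decoys :: "rvec set" where
  "decoys = {z. (\<forall>i<m. z i \<le> c i) \<and> (\<forall>i\<in>{m..<3 * m}. z i \<le> a + 1) \<and> card (big z) < m}"

definition F0 :: "rvec set" where
  "F0 = allocations (3 * m) \<inter> (nonpos \<union> decoys)"

definition F :: "nat set \<Rightarrow> rvec set" where
  "F S = allocations (3 * m) \<inter> (nonpos \<union> decoys \<union> {z. \<forall>i<3 * m. z i \<le> hidden S i})"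

definition A0 :: "rvec \<Rightarrow> rvec" where
  "A0 w = (\<lambda>i\<in>{..<3 * m}. 0)"

definition A :: "nat set \<Rightarrow> rvec \<Rightarrow> rvec" where
  "A S = A0(input S := hidden S)"

lemma h_pos: "0 < h"
  using l_pos l_less_h by simp

lemma q_ge_1: "1 \<le> q"
  using l_pos h_pos by (simp add: q_def)

lemma c_pos: "0 < c i"
  using m_pos q_ge_1 by (simp add: c_def)

lemma a_pos: "0 < a"
  using m_pos q_ge_1 by (simp add: a_def)

lemma sum_c: "l * m + h * (\<Sum>j<r. c j) = l * (m * q ^ r)"
proof (induction r)
  case (Suc r)
  have "l * q = l + 2 * m * h"
    using l_pos by (simp add: q_def field_simps)
  then have "l * (m * q ^ Suc r) = (l + 2 * m * h) * (m * q ^ r)"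
    by (simp add: ac_simps)
  with Suc show ?case
    by (simp add: c_def algebra_simps)
qed simp

lemma input_valuations: "input U \<in> valuations l h (3 * m)"
  by (auto simp: input_def valuations_def)

lemma input_nonneg: "i < 3 * m \<Longrightarrow> 0 \<le> input U i"
  using l_pos h_pos by (simp add: input_def)

lemma inj_input: "inj_on input (Pow {..<m})"
proof (rule inj_onI)
  fix S T assume sub: "S \<in> Pow {..<m}" "T \<in> Pow {..<m}" and eq: "input S = input T"
  have "i \<in> S \<longleftrightarrow> i \<in> T" if "i < m" for i
    using that l_less_h fun_cong[OF eq, of i] by (simp add: input_def split: if_splits)
  with sub show "S = T" by blast
qed

lemma algorithm_A0: "algorithm V F0 A0"
  by (auto simp: algorithm_def A0_def F0_def nonpos_def allocations_def)

lemma algorithm_A: "algorithm V (F S) (A S)"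
  by (auto simp: algorithm_def A_def A0_def F_def nonpos_def allocations_def hidden_def)

lemma decoys_update:
  assumes "z \<in> decoys" and "b \<le> z i"
  shows "z(i := b) \<in> decoys"
proof -
  have "big (z(i := b)) \<subseteq> big z" "finite (big z)"
    using assms(2) by (auto simp: big_def)
  then have "card (big (z(i := b))) \<le> card (big z)" by (rule card_mono[rotated])
  then show ?thesis
    using assms unfolding decoys_def by force
qed

lemma downward_closed_F0: "downward_closed (3 * m) F0"
  unfolding downward_closed_def F0_def
  by (auto simp: allocations_def nonpos_def decoys_update PiE_iff extensional_def intro: order_trans)

lemma downward_closed_F: "downward_closed (3 * m) (F S)"
  unfolding downward_closed_def F_def
  by (auto simp: allocations_def nonpos_def decoys_update PiE_iff extensional_def intro: order_trans)

section \<open>Welfare of the hidden vector and of decoys\<close>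

lemma sum_blocks:
  fixes f :: "nat \<Rightarrow> real"
  shows "(\<Sum>i<3 * m. f i) = (\<Sum>i<m. f i) + (\<Sum>i\<in>{m..<3 * m}. f i)"
  using sum.atLeastLessThan_concat[of 0 m "3 * m" f] by (simp add: lessThan_atLeast0)

lemma welfare_input:
  assumes "U \<subseteq> {..<m}"
  shows "welfare (3 * m) (input U) z = (\<Sum>i<m. input U i * z i) + l * (\<Sum>i\<in>{m..<3 * m}. z i)"
proof -
  have "(\<Sum>i\<in>{m..<3 * m}. input U i * z i) = l * (\<Sum>i\<in>{m..<3 * m}. z i)"
    unfolding sum_distrib_left using assms by (intro sum.cong) (auto simp: input_def)
  then show ?thesis by (simp add: welfare_def sum_blocks)
qed

text \<open>The two password amounts for \<open>j\<close> sum to 1 if \<open>j\<close> is in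
  \<open>S\<close> and to \<open>1 - c j\<close> otherwise, which cancels the value
  \<open>l * c j\<close> of the chain amount.\<close>

lemma welfare_hidden:
  assumes "U \<subseteq> {..<m}"
  shows "welfare (3 * m) (input U) (hidden S) = l * m + (\<Sum>j\<in>{..<m} - S. (input U j - l) * c j)"
proof -
  let ?f = "hidden S"
  have "(\<Sum>i\<in>{m..<3 * m}. ?f i) = (\<Sum>i\<in>{m..<2 * m}. ?f i) + (\<Sum>i\<in>{2 * m..<3 * m}. ?f i)"
    by (simp add: sum.atLeastLessThan_concat)
  also have "(\<Sum>i\<in>{m..<2 * m}. ?f i) = (\<Sum>j<m. ?f (j + m))"
    using sum.shift_bounds_nat_ivl[of ?f 0 m m] by (simp add: lessThan_atLeast0 mult_2)
  also have "(\<Sum>i\<in>{2 * m..<3 * m}. ?f i) = (\<Sum>j<m. ?f (j + 2 * m))"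
    using sum.shift_bounds_nat_ivl[of ?f 0 "2 * m" m] by (simp add: lessThan_atLeast0)
  finally have "(\<Sum>i\<in>{m..<3 * m}. ?f i) = (\<Sum>j<m. ?f (j + m) + ?f (j + 2 * m))"
    by (simp add: sum.distrib)
  also have "\<dots> = (\<Sum>j<m. 1 - (if j \<in> S then 0 else c j))"
    by (intro sum.cong) (auto simp: hidden_def)
  finally have "welfare (3 * m) (input U) ?f
      = (\<Sum>i<m. input U i * ?f i) + (\<Sum>j<m. l - l * (if j \<in> S then 0 else c j))"
    by (simp add: welfare_input[OF assms] sum_distrib_left right_diff_distrib)
  also have "\<dots> = (\<Sum>j<m. l + (if j \<in> S then 0 else (input U j - l) * c j))"
    unfolding sum.distrib[symmetric] by (intro sum.cong) (auto simp: hidden_def algebra_simps)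
  also have "\<dots> = l * m + (\<Sum>j<m. if j \<in> S then 0 else (input U j - l) * c j)"
    by (simp add: sum.distrib)
  also have "(\<Sum>j<m. if j \<in> S then 0 else (input U j - l) * c j)
      = (\<Sum>j\<in>{..<m} - S. (input U j - l) * c j)"
    by (intro sum.mono_neutral_cong_right) auto
  finally show ?thesis .
qed

lemma welfare_nonpos:
  assumes "z \<in> nonpos" and "r < 3 * m"
  shows "welfare (3 * m) (input U) z \<le> input U r * z r"
  using welfare_le_cap[of "3 * m" "input U" z "\<lambda>_. 0" r] assms input_nonneg
  by (simp add: nonpos_def welfare_def)

text \<open>Fewer than \<open>m\<close> of the \<open>2 * m\<close> password amounts exceed
  \<open>- a\<close>, so they sum to at most \<open>m - 1 - 2 * a\<close>. The chain agents
  contribute at most \<open>l * (a - m)\<close>, too little to compensate.\<close>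

lemma welfare_decoy:
  assumes "z \<in> decoys" and U: "U \<subseteq> {..<m}" and "r < m"
  shows "welfare (3 * m) (input U) z \<le> - l + input U r * (z r - c r)"
proof -
  \<comment> \<open>A coordinatewise upper bound of \<open>z\<close> that depends on
    \<open>z\<close> only through \<open>big z\<close>.\<close>
  define b where "b i = (if i < m then c i else if i \<in> big z then a + 1 else - a)" for i
  have big: "big z \<subseteq> {m..<3 * m}" "finite (big z)" by (auto simp: big_def)
  have "(\<Sum>i\<in>{m..<3 * m}. b i) = (\<Sum>i\<in>{m..<3 * m}. (if i \<in> big z then 2 * a + 1 else 0) - a)"
    by (intro sum.cong) (auto simp: b_def)
  also have "\<dots> = (\<Sum>i\<in>big z. 2 * a + 1) - 2 * m * a"
    unfolding sum_subtractf using big(1)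
    by (subst sum.mono_neutral_cong_right[of "{m..<3 * m}" "big z" _ "\<lambda>_. 2 * a + 1"]) auto
  also have "\<dots> = card (big z) * (2 * a + 1) - 2 * m * a"
    by simp
  also have "\<dots> \<le> (real m - 1) * (2 * a + 1) - 2 * m * a"
    using assms(1) a_pos by (intro diff_right_mono mult_right_mono) (auto simp: decoys_def)
  also have "\<dots> = real m - 1 - 2 * a"
    by (simp add: algebra_simps)
  finally have N: "(\<Sum>i\<in>{m..<3 * m}. b i) \<le> real m - 1 - 2 * a" .
  have "(\<Sum>i<m. input U i * b i) \<le> (\<Sum>i<m. h * c i)"
    using c_pos l_less_h by (intro sum_mono) (auto simp: b_def input_def intro!: mult_right_mono less_imp_le)
  also have "\<dots> = l * a - l * m"
    using sum_c[of m] by (simp add: a_def sum_distrib_left)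
  finally have "welfare (3 * m) (input U) b \<le> l * a - l * m + l * (real m - 1 - 2 * a)"
    unfolding welfare_input[OF U] using l_pos N by (intro add_mono mult_left_mono) auto
  also have "\<dots> \<le> - l"
    using l_pos a_pos by (simp add: algebra_simps)
  finally have "welfare (3 * m) (input U) b \<le> - l" .
  moreover have "z i \<le> b i" if "i < 3 * m" for i
    using assms(1) that by (auto simp: decoys_def b_def big_def not_less)
  then have "welfare (3 * m) (input U) z \<le> welfare (3 * m) (input U) b + input U r * (z r - b r)"
    using assms(3) by (intro welfare_le_cap input_nonneg) auto
  ultimately show ?thesis using \<open>r < m\<close> by (simp add: b_def)
qed

section \<open>Feasible allocations and what a single query reveals\<close>

lemma F_cases:
  assumes "z \<in> F S"
  obtains "z \<in> nonpos" | "z \<in> decoys" "z \<notin> nonpos"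
    | "\<And>i. i < 3 * m \<Longrightarrow> z i \<le> hidden S i" "z \<notin> nonpos"
  using assms unfolding F_def by blast

lemma le_cap_if_F:
  assumes "z \<in> F S" and "r < m"
  shows "z r \<le> c r * indicator (- nonpos) z"
proof (cases "z \<in> nonpos")
  case False
  have "hidden S r \<le> c r"
    using \<open>r < m\<close> c_pos[of r] by (simp add: hidden_def)
  moreover have "z \<in> decoys \<or> z r \<le> hidden S r"
    using assms False by (auto simp: F_def)
  ultimately show ?thesis
    using False \<open>r < m\<close> by (auto simp: decoys_def)
qed (use assms(2) in \<open>simp add: nonpos_def\<close>)

text \<open>An allocation in \<open>F T\<close> but not in \<open>F0\<close> lies below
  \<open>hidden T\<close> and is not a decoy. So it exceeds \<open>- a\<close> at all
  \<open>m\<close> positions where \<open>hidden T\<close> does and nowhere else in the password,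
  and these positions spell out \<open>T\<close>.\<close>

lemma query_reveals_at_most_one:
  "\<exists>S. \<forall>T\<in>Pow {..<m} - {S}. z \<in> F T \<longleftrightarrow> z \<in> F0"
proof -
  \<comment> \<open>These are the positions in \<open>big (hidden S)\<close>.\<close>
  define plus where "plus S = (\<lambda>j. if j \<in> S then j + 2 * m else j + m) ` {..<m}" for S
  have mem_plus: "j \<in> S \<longleftrightarrow> j + m \<notin> plus S" if "j < m" for j S
    using that by (auto simp: plus_def split: if_splits)
  have *: "big z = plus T" if "z \<in> F T" "z \<notin> F0" for T
  proof -
    have le: "\<And>i. i < 3 * m \<Longrightarrow> z i \<le> hidden T i" and not: "z \<notin> decoys"
      using that by (auto simp: F_def F0_def)
    have "z i \<le> c i" if "i < m" for i
      using that c_pos[of i] le[of i] by (auto simp: hidden_def split: if_splits)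
    moreover have "z i \<le> a + 1" if "i \<in> {m..<3 * m}" for i
      using that a_pos c_pos[of "i - 2 * m"] le[of i] by (auto simp: hidden_def split: if_splits)
    ultimately have "m \<le> card (big z)"
      using not unfolding decoys_def by (simp add: not_less)
    moreover have "inj_on (\<lambda>j. if j \<in> T then j + 2 * m else j + m) {..<m}"
      by (auto simp: inj_on_def)
    then have "card (plus T) = m"
      by (simp only: plus_def card_image card_lessThan)
    moreover have "big z \<subseteq> plus T"
    proof
      fix i assume "i \<in> big z"
      then have i: "i \<in> {m..<3 * m}" "- a < hidden T i"
        using le[of i] by (auto simp: big_def)
      show "i \<in> plus T"
      proof (cases "i < 2 * m")
        case True
        with i have "i = (if i - m \<in> T then (i - m) + 2 * m else (i - m) + m)"
          by (auto simp: hidden_def split: if_splits)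
        moreover have "i - m < m" using True i by auto
        ultimately show ?thesis unfolding plus_def by blast
      next
        case False
        with i c_pos[of "i - 2 * m"]
        have "i = (if i - 2 * m \<in> T then (i - 2 * m) + 2 * m else (i - 2 * m) + m)"
          by (auto simp: hidden_def split: if_splits)
        moreover have "i - 2 * m < m" using False i by auto
        ultimately show ?thesis unfolding plus_def by blast
      qed
    qed
    moreover have "finite (plus T)" by (simp add: plus_def)
    ultimately show ?thesis by (metis card_subset_eq card_mono le_antisym)
  qed
  have mono: "z \<in> F T" if "z \<in> F0" for T
    using that by (auto simp: F_def F0_def)
  have uniq: "S = T" if "z \<in> F S" "z \<in> F T" "z \<notin> F0" "S \<subseteq> {..<m}" "T \<subseteq> {..<m}" for S T
    using *[OF that(1,3)] *[OF that(2,3)] mem_plus[of _ S] mem_plus[of _ T] that(4,5) by auto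
  show ?thesis
  proof (cases "z \<notin> F0 \<and> (\<exists>S. S \<subseteq> {..<m} \<and> z \<in> F S)")
    case True
    then obtain S where "S \<subseteq> {..<m}" "z \<in> F S" "z \<notin> F0" by blast
    with uniq show ?thesis by (intro exI[of _ S]) blast
  qed (use mono in blast)
qed

lemma oracle_reveals_at_most_one: "\<exists>S. \<forall>T\<in>Pow {..<m} - {S}. A T w = A0 w"
proof (cases "w \<in> input ` Pow {..<m}")
  case True
  then obtain S where "S \<in> Pow {..<m}" "w = input S" by blast
  then show ?thesis
    using inj_onD[OF inj_input] by (intro exI[of _ S]) (auto simp: A_def)
next
  case False
  then show ?thesis by (auto simp: A_def)
qed

section \<open>Welfare along the chain of inputs, and the environment without a secret\<close>

lemma welfare_A_nonneg:
  assumes "U \<subseteq> {..<m}"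
  shows "0 \<le> welfare (3 * m) (input U) (A S (input U))"
proof -
  have "0 \<le> (\<Sum>j\<in>{..<m} - S. (input U j - l) * c j)"
    using l_less_h c_pos by (intro sum_nonneg) (auto simp: input_def less_imp_le)
  then have "0 \<le> welfare (3 * m) (input U) (hidden S)"
    using l_pos by (simp add: welfare_hidden[OF assms])
  moreover have "welfare (3 * m) (input U) (A0 w) = 0" for w
    by (simp add: welfare_def A0_def)
  ultimately show ?thesis by (cases "input U = input S") (auto simp: A_def)
qed

lemma welfare_hidden_le:
  assumes "U \<subseteq> {..<m}" and "U - S \<subseteq> {..<r}" and "r \<le> m"
  shows "welfare (3 * m) (input U) (hidden S) \<le> l * (m * q ^ r)"
proof -
  have "(\<Sum>j\<in>{..<m} - S. (input U j - l) * c j) \<le> (\<Sum>j\<in>{..<m} - S. if j < r then h * c j else 0)"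
    using assms l_pos h_pos c_pos
    by (intro sum_mono) (auto simp: input_def less_imp_le intro!: mult_right_mono)
  also have "\<dots> \<le> (\<Sum>j<m. if j < r then h * c j else 0)"
    using h_pos c_pos by (intro sum_mono2) (auto simp: less_imp_le)
  also have "\<dots> = (\<Sum>j<r. h * c j)"
    using \<open>r \<le> m\<close> by (intro sum.mono_neutral_cong_right) auto
  finally show ?thesis
    using sum_c[of r] by (simp add: welfare_hidden[OF assms(1)] sum_distrib_left)
qed

text \<open>Without a secret, an output outside \<open>nonpos\<close> is a decoy and has welfare at
  most \<open>- l\<close>, while all others have welfare at most 0. Nonnegative expected welfare
  leaves no mass on decoys outside \<open>nonpos\<close>.\<close>

lemma prob_nonpos_base:
  fixes P :: "rvec pmf"
  assumes "finite (set_pmf P)" and "set_pmf P \<subseteq> F0" and U: "U \<subseteq> {..<m}"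
    and "0 \<le> measure_pmf.expectation P (welfare (3 * m) (input U))"
  shows "measure_pmf.prob P (- nonpos) = 0"
proof -
  have int: "integrable P f" for f :: "rvec \<Rightarrow> real"
    using assms(1) by (rule integrable_measure_pmf_finite)
  have "welfare (3 * m) (input U) z \<le> - l * indicator (- nonpos) z" if "z \<in> F0" for z
  proof (cases "z \<in> nonpos")
    case True
    then have "input U 0 * z 0 \<le> 0"
      using m_pos input_nonneg[of 0 U] by (auto simp: nonpos_def mult_nonneg_nonpos)
    with welfare_nonpos[OF True, of 0 U] m_pos True show ?thesis by simp
  next
    case False
    with that have z: "z \<in> decoys" by (auto simp: F0_def)
    then have "input U 0 * (z 0 - c 0) \<le> 0"
      using m_pos input_nonneg[of 0 U] by (auto simp: decoys_def mult_nonneg_nonpos)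
    with welfare_decoy[OF z U m_pos] False show ?thesis by simp
  qed
  then have "measure_pmf.expectation P (welfare (3 * m) (input U))
      \<le> measure_pmf.expectation P (\<lambda>z. - l * indicator (- nonpos) z)"
    using assms(2) by (intro integral_mono_AE int) (auto simp: AE_measure_pmf_iff)
  also have "\<dots> = - l * measure_pmf.prob P (- nonpos)"
    by simp
  finally have "l * measure_pmf.prob P (- nonpos) \<le> 0"
    using assms(4) by simp
  then show ?thesis
    using l_pos by (simp add: mult_le_0_iff measure_le_0_iff)
qed

section \<open>The chain argument for a fixed secret\<close>

context
  fixes S :: "nat set" and R :: "rvec \<Rightarrow> rvec pmf"
  assumes S: "S \<subseteq> {..<m}"
    and fin: "\<And>v. finite (set_pmf (R v))"
    and feasible: "\<And>v. v \<in> valuations l h (3 * m) \<Longrightarrow> set_pmf (R v) \<subseteq> F S"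
    and monotone: "monotone_rule l h (3 * m) R"
    and preserving: "\<And>v. v \<in> valuations l h (3 * m) \<Longrightarrow>
      welfare (3 * m) v (A S v) \<le> measure_pmf.expectation (R v) (welfare (3 * m) v)"
begin

lemma expectation_mono:
  fixes f g :: "rvec \<Rightarrow> real"
  assumes "\<And>z. z \<in> F S \<Longrightarrow> f z \<le> g z"
  shows "measure_pmf.expectation (R (input U)) f \<le> measure_pmf.expectation (R (input U)) g"
  using feasible[OF input_valuations] assms
  by (intro integral_mono_AE integrable_measure_pmf_finite fin) (auto simp: AE_measure_pmf_iff)

text \<open>The required welfare \<open>l * m\<close> is the maximum over \<open>F S\<close> at this
  input, and outputs in \<open>nonpos\<close> have welfare at most 0.\<close>

lemma prob_hidden_start: "1 \<le> measure_pmf.prob (R (input S)) (- nonpos)"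
proof -
  have W: "welfare (3 * m) (input S) (hidden S) = l * m"
    unfolding welfare_hidden[OF S] by (auto simp: input_def)
  have "welfare (3 * m) (input S) z \<le> l * m * indicator (- nonpos) z" if "z \<in> F S" for z
  proof -
    show ?thesis
      using that
    proof (cases rule: F_cases)
      case 1
      then have "input S 0 * z 0 \<le> 0"
        using m_pos input_nonneg[of 0 S] by (auto simp: nonpos_def mult_nonneg_nonpos)
      with welfare_nonpos[OF 1, of 0 S] m_pos 1 show ?thesis by simp
    next
      case 2
      then have "input S 0 * (z 0 - c 0) \<le> 0"
        using m_pos input_nonneg[of 0 S] by (auto simp: decoys_def mult_nonneg_nonpos)
      moreover have "0 \<le> l * m" using l_pos by simp
      ultimately have "welfare (3 * m) (input S) z \<le> l * m"
        using welfare_decoy[OF 2(1) S m_pos] l_pos by linarith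
      then show ?thesis using 2(2) by simp
    next
      case 3
      have "welfare (3 * m) (input S) z \<le> welfare (3 * m) (input S) (hidden S)"
        unfolding welfare_def using 3 by (intro sum_mono mult_left_mono input_nonneg) auto
      then show ?thesis using 3 W by simp
    qed
  qed
  then have "measure_pmf.expectation (R (input S)) (welfare (3 * m) (input S))
      \<le> measure_pmf.expectation (R (input S)) (\<lambda>z. l * m * indicator (- nonpos) z)"
    by (rule expectation_mono)
  also have "\<dots> = l * m * measure_pmf.prob (R (input S)) (- nonpos)"
    by simp
  finally have "l * m * 1 \<le> l * m * measure_pmf.prob (R (input S)) (- nonpos)"
    using preserving[OF input_valuations, of S] W by (simp add: A_def)
  then show ?thesis
    using l_pos m_pos by (subst (asm) mult_le_cancel_left_pos) auto
qed

text \<open>If agent \<open>r\<close> is not in \<open>S\<close>, nonnegative welfare before raising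
  it gives \<open>(c r - M) * p\<close> as a lower bound on its expected amount. Monotonicity
  carries this over to the raised input, where the amount is at most
  \<open>c r * p'\<close>.\<close>

lemma prob_hidden_step:
  assumes "r < m"
  shows "measure_pmf.prob (R (input (S \<union> {..<r}))) (- nonpos) - 1 / (2 * m)
           \<le> measure_pmf.prob (R (input (S \<union> {..<Suc r}))) (- nonpos)"
proof (cases "r \<in> S")
  case True
  then have "S \<union> {..<Suc r} = S \<union> {..<r}" by (auto simp: less_Suc_eq)
  then show ?thesis by simp
next
  case False
  define U where "U = S \<union> {..<r}"
  define p where "p = measure_pmf.prob (R (input U)) (- nonpos)"
  define p' where "p' = measure_pmf.prob (R (input (insert r U))) (- nonpos)"
  define M where "M = m * q ^ r"
  have U: "U \<subseteq> {..<m}" using S assms by (auto simp: U_def)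
  have M: "0 < M" and c: "c r = 2 * m * M" using m_pos q_ge_1 by (auto simp: M_def c_def)
  have r: "input U r = l" "r < 3 * m" using False assms by (auto simp: input_def U_def)
  \<comment> \<open>The bound is linear in the indicator and in \<open>z r\<close>, and agent
    \<open>r\<close> still has value \<open>l\<close>. Hence its expectation involves only
    \<open>p\<close> and the expected amount of \<open>r\<close>.\<close>
  have "welfare (3 * m) (input U) z \<le> l * (M - c r) * indicator (- nonpos) z + l * z r"
    if "z \<in> F S" for z
  proof -
    show ?thesis
      using that
    proof (cases rule: F_cases)
      case 1
      with welfare_nonpos[OF 1 r(2), of U] r show ?thesis by simp
    next
      case 2
      have "0 \<le> l * M" using l_pos M by simp
      with 2 welfare_decoy[OF 2(1) U assms] r l_pos show ?thesis
        by (simp add: algebra_simps)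
    next
      case 3
      have "welfare (3 * m) (input U) (hidden S) \<le> l * M"
        unfolding M_def using U assms by (intro welfare_hidden_le) (auto simp: U_def)
      moreover have "welfare (3 * m) (input U) z
          \<le> welfare (3 * m) (input U) (hidden S) + input U r * (z r - hidden S r)"
        using 3 r by (intro welfare_le_cap input_nonneg) auto
      moreover have "hidden S r = c r" using False assms by (simp add: hidden_def)
      ultimately show ?thesis using r 3 by (simp add: algebra_simps)
    qed
  qed
  then have "measure_pmf.expectation (R (input U)) (welfare (3 * m) (input U))
      \<le> measure_pmf.expectation (R (input U)) (\<lambda>z. l * (M - c r) * indicator (- nonpos) z + l * z r)"
    by (rule expectation_mono)
  also have "\<dots> = l * (M - c r) * p + l * measure_pmf.expectation (R (input U)) (\<lambda>z. z r)"
    unfolding p_def by (subst Bochner_Integration.integral_add) (auto intro!: integrable_measure_pmf_finite fin)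
  finally have "0 \<le> l * ((M - c r) * p + measure_pmf.expectation (R (input U)) (\<lambda>z. z r))"
    using preserving[OF input_valuations, of U] welfare_A_nonneg[OF U, of S] by (simp add: distrib_left mult.assoc)
  then have "0 \<le> (M - c r) * p + measure_pmf.expectation (R (input U)) (\<lambda>z. z r)"
    using l_pos by (simp only: zero_le_mult_iff) auto
  then have "(c r - M) * p \<le> measure_pmf.expectation (R (input U)) (\<lambda>z. z r)"
    by (simp add: left_diff_distrib)
  also have "\<dots> \<le> measure_pmf.expectation (R ((input U)(r := h))) (\<lambda>z. z r)"
    using monotone input_valuations r l_less_h unfolding monotone_rule_def by auto
  also have "(input U)(r := h) = input (insert r U)"
    using r(2) by (auto simp: input_def fun_eq_iff)
  also have "measure_pmf.expectation (R (input (insert r U))) (\<lambda>z. z r)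
      \<le> measure_pmf.expectation (R (input (insert r U))) (\<lambda>z. c r * indicator (- nonpos) z)"
    using assms by (intro expectation_mono le_cap_if_F)
  also have "\<dots> = c r * p'"
    by (simp add: p'_def)
  \<comment> \<open>Substituting \<open>c r = 2 * m * M\<close> makes the relative loss
    \<open>1 / (2 * m)\<close>, whatever \<open>r\<close> is.\<close>
  finally have "M * ((2 * real m - 1) * p) \<le> M * (2 * m * p')"
    by (simp add: c algebra_simps)
  then have "(2 * real m - 1) * p \<le> 2 * m * p'"
    using M by simp
  moreover have "p \<le> 1" by (simp add: p_def)
  ultimately have "p - 1 / (2 * m) \<le> p'"
    using m_pos by (simp add: field_simps)
  moreover have "insert r U = S \<union> {..<Suc r}" by (auto simp: U_def)
  ultimately show ?thesis by (simp add: p_def p'_def U_def)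
qed

lemma prob_hidden: "1 / 2 \<le> measure_pmf.prob (R (input {..<m})) (- nonpos)"
proof -
  have "1 - r / (2 * m) \<le> measure_pmf.prob (R (input (S \<union> {..<r}))) (- nonpos)" if "r \<le> m" for r
    using that
  proof (induction r)
    case 0
    then show ?case using prob_hidden_start by simp
  next
    case (Suc r)
    then show ?case using prob_hidden_step[of r] by (simp add: add_divide_distrib)
  qed
  from this[of m] S m_pos show ?thesis by (simp add: Un_absorb1)
qed

end

section \<open>Summing over all secrets\<close>

lemma no_fast_transformation:
  assumes transformation: "\<And>F A v. downward_closed (3 * m) F \<Longrightarrow> algorithm (valuations l h (3 * m)) F A \<Longrightarrow>
      v \<in> valuations l h (3 * m) \<Longrightarrow> set_pmf (outcome A F (T v)) \<subseteq> F"
    and monotone: "\<And>F A. downward_closed (3 * m) F \<Longrightarrow> algorithm (valuations l h (3 * m)) F A \<Longrightarrow>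
      monotone_rule l h (3 * m) (\<lambda>v. outcome A F (T v))"
    and preserving: "\<And>F A v. downward_closed (3 * m) F \<Longrightarrow> algorithm (valuations l h (3 * m)) F A \<Longrightarrow>
      v \<in> valuations l h (3 * m) \<Longrightarrow>
      welfare (3 * m) v (A v) \<le> measure_pmf.expectation (outcome A F (T v)) (welfare (3 * m) v)"
  shows "2 ^ m \<le> 2 * time A0 F0 (T (input {..<m}))"
proof -
  let ?v = "input {..<m}"
  let ?p = "\<lambda>A F. measure_pmf.prob (outcome A F (T ?v)) (- nonpos)"
  have "welfare (3 * m) ?v (A0 ?v) = 0"
    by (simp add: welfare_def A0_def)
  then have base: "?p A0 F0 = 0"
    using transformation[OF downward_closed_F0 algorithm_A0 input_valuations]
      preserving[OF downward_closed_F0 algorithm_A0 input_valuations, of "{..<m}"]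
    by (intro prob_nonpos_base[of _ "{..<m}"] finite_set_pmf_outcome) auto
  have "1 / 2 \<le> ?p (A S) (F S)" if "S \<in> Pow {..<m}" for S
    using that transformation[OF downward_closed_F algorithm_A] monotone[OF downward_closed_F algorithm_A]
      preserving[OF downward_closed_F algorithm_A]
    by (intro prob_hidden[of S "\<lambda>v. outcome (A S) (F S) (T v)"] finite_set_pmf_outcome) auto
  then have "(\<Sum>S\<in>Pow {..<m}. 1 / 2) \<le> (\<Sum>S\<in>Pow {..<m}. ?p (A S) (F S))"
    by (rule sum_mono)
  \<comment> \<open>All \<open>2 ^ m\<close> secrets share the input \<open>?v\<close>, hence the
    same computation \<open>T ?v\<close>, so the query count applies to it.\<close>
  also have "\<dots> \<le> time A0 F0 (T ?v) + card (Pow {..<m}) * ?p A0 F0"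
    by (intro sum_prob_outcome_le_time oracle_reveals_at_most_one query_reveals_at_most_one) simp
  finally have "real (2 ^ m) \<le> real (2 * time A0 F0 (T ?v))"
    by (simp add: base card_Pow)
  then show ?thesis by (simp only: of_nat_le_iff)
qed

end

theorem theorem1:
  fixes l h :: "nat \<Rightarrow> real"
  assumes "\<And>n. 0 < l n" and "\<And>n. l n < h n"
  shows "\<not> (\<exists>T. transformation l h T \<and> polynomial_time l h T \<and>
                monotone_transformation l h T \<and> welfare_preserving l h T)"
proof
  assume "\<exists>T. transformation l h T \<and> polynomial_time l h T \<and>
    monotone_transformation l h T \<and> welfare_preserving l h T"
  then obtain T p where T: "transformation l h T" "monotone_transformation l h T" "welfare_preserving l h T"
    and p: "\<And>n F A v. downward_closed n F \<Longrightarrow> algorithm (valuations (l n) (h n) n) F A \<Longrightarrow>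
      v \<in> valuations (l n) (h n) n \<Longrightarrow> time A F (T n v) \<le> poly p n"
    unfolding polynomial_time_def by blast
  obtain m where m: "0 < m" "2 * poly p (3 * m) < 2 ^ m"
    using nat_poly_less_power2 by blast
  \<comment> \<open>Only one number of agents, \<open>3 * m\<close>, is considered, so
    \<open>l\<close> and \<open>h\<close> may depend on it arbitrarily.\<close>
  interpret hidden_set m "l (3 * m)" "h (3 * m)"
    using m(1) assms by unfold_locales
  have "2 ^ m \<le> 2 * time A0 F0 (T (3 * m) (input {..<m}))"
    using T by (intro no_fast_transformation)
      (auto simp: transformation_def monotone_transformation_def welfare_preserving_def apply_transf_def [abs_def])
  also have "\<dots> \<le> 2 * poly p (3 * m)"
    using p[OF downward_closed_F0 algorithm_A0 input_valuations] by simp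
  finally show False using m(2) by simp
qed

end
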